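(* Let $q_1,q_2$ be prime powers and $\nu_1,\nu_2\geq 1$ integers. Then the graphs $Spi(2\nu_1,q_1)$ and $Spi(2\nu_2,q_2)$ are isomorphic if and only if $\nu_1=\nu_2$ and $q_1=q_2$.
   Context: For a prime power $q$ and $\nu\ge1$, let $\mathbb{F}_q$ be the field with $q$ elements, $\mathbb{F}_q^{(2\nu)}$ the space of row vectors of length $2\nu$, and $K_{2\nu}=\begin{pmatrix}0 & I^{(\nu)}\\ -I^{(\nu)} & 0\end{pmatrix}$. A subspace of dimension $m$ is identified with any $m\times 2\nu$ matrix whose rows form a basis of it. The symplectic inner product graph $Spi(2\nu,q)$ has as vertex set all subspaces of $\mathbb{F}_q^{(2\nu)}$ other than $0$ and $\mathbb{F}_q^{(2\nu)}$, and vertices $A,B$ (not necessarily distinct) are adjacent iff $AK_{2\nu}{}^tB=0$, i.e. $\alpha K_{2\nu}{}^t\beta=0$ for all $\alpha\in A,\beta\in B$. *)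

theory Defs
  imports
    "Jordan_Normal_Form.VS_Connect"
    "Graph_Theory.Graph_Theory"
    "HOL-Number_Theory.Prime_Powers"
    "HOL-Library.Cardinality"
begin

definition symplectic_mat :: "nat \<Rightarrow> 'a::field mat" where
  "symplectic_mat \<nu> = four_block_mat (0\<^sub>m \<nu> \<nu>) (1\<^sub>m \<nu>) (- 1\<^sub>m \<nu>) (0\<^sub>m \<nu> \<nu>)"

(* A row vector a and a column vector transpose b are both of type vec,
   so that a K (transpose b) is the scalar product of a with K b. *)
definition symplectic_form :: "nat \<Rightarrow> 'a::field vec \<Rightarrow> 'a vec \<Rightarrow> 'a" where
  "symplectic_form \<nu> a b = a \<bullet> (symplectic_mat \<nu> *\<^sub>v b)"

definition Spi_verts :: "'a::field itself \<Rightarrow> nat \<Rightarrow> 'a vec set set" where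
  "Spi_verts TYPE('a) \<nu> =
     {W. VectorSpace.subspace class_ring W (module_vec TYPE('a) (2 * \<nu>)) \<and>
         W \<noteq> {0\<^sub>v (2 * \<nu>)} \<and> W \<noteq> carrier_vec (2 * \<nu>)}"

(* An undirected graph with loops is represented by its symmetric arc relation,
   with a loop (A, A) for every totally isotropic A. *)
definition Spi :: "'a::field itself \<Rightarrow> nat \<Rightarrow> 'a vec set pair_pre_digraph" where
  "Spi TYPE('a) \<nu> = \<lparr>
     pverts = Spi_verts TYPE('a) \<nu>,
     parcs = {(A, B). A \<in> Spi_verts TYPE('a) \<nu> \<and> B \<in> Spi_verts TYPE('a) \<nu> \<and>
                (\<forall>a\<in>A. \<forall>b\<in>B. symplectic_form \<nu> a b = 0)} \<rparr>"

lemma symplectic_mat_carrier [simp]: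
  "symplectic_mat \<nu> \<in> carrier_mat (2 * \<nu>) (2 * \<nu>)"
  unfolding symplectic_mat_def mult_2 by (rule four_block_carrier_mat) auto

lemma symplectic_mat_transpose:
  "transpose_mat (symplectic_mat \<nu>) = - (symplectic_mat \<nu> :: 'a::field mat)"
  by (rule eq_matI) (auto simp: symplectic_mat_def)

lemma symplectic_form_skew:
  fixes a b :: "'a::field vec"
  assumes "a \<in> carrier_vec (2 * \<nu>)" "b \<in> carrier_vec (2 * \<nu>)"
  shows "symplectic_form \<nu> b a = - symplectic_form \<nu> a b"
proof -
  let ?K = "symplectic_mat \<nu> :: 'a mat"
  have K: "?K \<in> carrier_mat (2 * \<nu>) (2 * \<nu>)" by simp
  have Kb: "?K *\<^sub>v b \<in> carrier_vec (2 * \<nu>)" using K assms(2) by (rule mult_mat_vec_carrier)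
  have "symplectic_form \<nu> b a = (transpose_mat ?K *\<^sub>v b) \<bullet> a"
    unfolding symplectic_form_def using transpose_vec_mult_scalar[OF K assms(1,2)] by simp
  also have "\<dots> = (- (?K *\<^sub>v b)) \<bullet> a"
  proof -
    have "- ?K *\<^sub>v b = - (?K *\<^sub>v b)"
      using carrier_matD(2)[OF K] assms(2) by (intro uminus_mult_mat_vec) simp
    then show ?thesis by (simp add: symplectic_mat_transpose)
  qed
  also have "\<dots> = - (a \<bullet> (?K *\<^sub>v b))"
    using uminus_scalar_prod[OF Kb assms(1)] comm_scalar_prod[OF assms(1) Kb] by simp
  finally show ?thesis unfolding symplectic_form_def .
qed

lemma Spi_verts_carrier:
  fixes W :: "'a::field vec set"
  assumes "W \<in> Spi_verts TYPE('a) \<nu>" shows "W \<subseteq> carrier_vec (2 * \<nu>)"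
  using assms unfolding Spi_verts_def VectorSpace.subspace_def submodule_def
  by (auto simp: module_vec_simps)

lemma finite_carrier_vec: "finite (carrier_vec n :: 'a::finite vec set)"
proof -
  have "finite {xs :: 'a list. set xs \<subseteq> UNIV \<and> length xs = n}"
    by (rule finite_lists_length_eq) simp
  moreover have "carrier_vec n \<subseteq> vec_of_list ` {xs :: 'a list. set xs \<subseteq> UNIV \<and> length xs = n}"
  proof
    fix v :: "'a vec" assume "v \<in> carrier_vec n"
    then have "v = vec_of_list (list_of_vec v)" "length (list_of_vec v) = n"
      by (auto simp: vec_list)
    then show "v \<in> vec_of_list ` {xs :: 'a list. set xs \<subseteq> UNIV \<and> length xs = n}" by blast
  qed
  ultimately show ?thesis by (rule finite_surj)
qed

lemma Spi_pseudo_graph: "pair_pseudo_graph (Spi TYPE('a::{field,finite}) \<nu>)"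
proof -
  have "Spi_verts TYPE('a) \<nu> \<subseteq> Pow (carrier_vec (2 * \<nu>))"
    using Spi_verts_carrier by auto
  then have fin: "finite (Spi_verts TYPE('a) \<nu>)"
    by (rule finite_subset) (simp add: finite_carrier_vec)
  have "parcs (Spi TYPE('a) \<nu>) \<subseteq> Spi_verts TYPE('a) \<nu> \<times> Spi_verts TYPE('a) \<nu>"
    by (auto simp: Spi_def)
  then have fin': "finite (parcs (Spi TYPE('a) \<nu>))"
    by (rule finite_subset) (simp add: fin)
  have sym: "(B, A) \<in> parcs (Spi TYPE('a) \<nu>)" if "(A, B) \<in> parcs (Spi TYPE('a) \<nu>)" for A B
  proof -
    have V: "A \<in> Spi_verts TYPE('a) \<nu>" "B \<in> Spi_verts TYPE('a) \<nu>"
      and z: "\<And>a b. a \<in> A \<Longrightarrow> b \<in> B \<Longrightarrow> symplectic_form \<nu> a b = 0"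
      using that by (auto simp: Spi_def)
    have "symplectic_form \<nu> b a = 0" if "a \<in> A" "b \<in> B" for a b
      using symplectic_form_skew[of a \<nu> b] z that Spi_verts_carrier[OF V(1)] Spi_verts_carrier[OF V(2)]
      by auto
    then show ?thesis using V by (auto simp: Spi_def)
  qed
  show ?thesis
    by unfold_locales
      (use fin fin' sym in \<open>auto simp: Spi_def symmetric_def arcs_ends_def intro!: symI\<close>)
qed

lemma digraph_iso_with_proj_iff:
  assumes "pair_wf_digraph G" "pair_wf_digraph H"
  shows "digraph_iso (with_proj G) (with_proj H) \<longleftrightarrow>
    (\<exists>f. bij_betw f (pverts G) (pverts H) \<and>
      (\<forall>u\<in>pverts G. \<forall>v\<in>pverts G. (u, v) \<in> parcs G \<longleftrightarrow> (f u, f v) \<in> parcs H))"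
    (is "?L \<longleftrightarrow> ?R")
proof
  interpret G: pair_wf_digraph G by fact
  interpret H: pair_wf_digraph H by fact
  assume ?L
  then obtain h where h: "inj_on (iso_verts h) (pverts G)"
      "\<And>a. a \<in> parcs G \<Longrightarrow> iso_verts h (fst a) = iso_tail h (iso_arcs h a)"
      "\<And>a. a \<in> parcs G \<Longrightarrow> iso_verts h (snd a) = iso_head h (iso_arcs h a)"
    and H: "with_proj H = app_iso h (with_proj G)"
    unfolding digraph_iso_def pre_digraph.digraph_isomorphism_def by auto
  have HV: "pverts H = iso_verts h ` pverts G" and HA: "parcs H = iso_arcs h ` parcs G"
    and ht: "iso_tail h = fst" "iso_head h = snd"
    using arg_cong[OF H, of verts] arg_cong[OF H, of arcs]
      arg_cong[OF H, of tail] arg_cong[OF H, of head] by auto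
  have arc: "iso_arcs h a = (iso_verts h (fst a), iso_verts h (snd a))" if "a \<in> parcs G" for a
    using h(2,3)[OF that] ht by (simp add: prod_eq_iff)
  have "(u, v) \<in> parcs G \<longleftrightarrow> (iso_verts h u, iso_verts h v) \<in> parcs H"
    if uv: "u \<in> pverts G" "v \<in> pverts G" for u v
  proof
    assume "(u, v) \<in> parcs G"
    then show "(iso_verts h u, iso_verts h v) \<in> parcs H"
      unfolding HA using arc[of "(u, v)"] by force
  next
    assume "(iso_verts h u, iso_verts h v) \<in> parcs H"
    then obtain a where a: "a \<in> parcs G" "(iso_verts h u, iso_verts h v) = iso_arcs h a"
      unfolding HA by auto
    then have "fst a = u" "snd a = v"
      using arc[OF a(1)] h(1) uv G.arc_fst_in_verts G.arc_snd_in_verts by (auto dest: inj_onD)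
    then show "(u, v) \<in> parcs G" using a(1) by (cases a) auto
  qed
  then show ?R using h(1) HV by (intro exI[of _ "iso_verts h"]) (auto simp: bij_betw_def)
next
  interpret G: pair_wf_digraph G by fact
  interpret H: pair_wf_digraph H by fact
  assume ?R
  then obtain f where f: "inj_on f (pverts G)" "f ` pverts G = pverts H"
    and adj: "\<And>u v. u \<in> pverts G \<Longrightarrow> v \<in> pverts G \<Longrightarrow> (u, v) \<in> parcs G \<longleftrightarrow> (f u, f v) \<in> parcs H"
    by (auto simp: bij_betw_def)
  let ?h = "\<lparr>iso_verts = f, iso_arcs = map_prod f f, iso_head = snd, iso_tail = fst\<rparr>"
  have sub: "parcs G \<subseteq> pverts G \<times> pverts G"
    using G.arc_fst_in_verts G.arc_snd_in_verts by force
  have "inj_on (map_prod f f) (parcs G)"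
    using map_prod_inj_on[OF f(1) f(1)] sub by (rule inj_on_subset)
  moreover have "parcs H = map_prod f f ` parcs G"
  proof (intro equalityI subsetI)
    fix e assume e: "e \<in> parcs H"
    then have "fst e \<in> f ` pverts G" "snd e \<in> f ` pverts G"
      using H.arc_fst_in_verts H.arc_snd_in_verts f(2) by auto
    then obtain u v where "u \<in> pverts G" "v \<in> pverts G" "e = (f u, f v)" by (cases e) auto
    with adj e show "e \<in> map_prod f f ` parcs G" by force
  next
    fix e assume "e \<in> map_prod f f ` parcs G"
    with adj sub show "e \<in> parcs H" by auto
  qed
  ultimately show ?L unfolding digraph_iso_def pre_digraph.digraph_isomorphism_def
    using f assms by (intro exI[of _ ?h]) (auto simp: app_iso_def with_proj_def wf_digraph_wp_iff[unfolded with_proj_def])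
qed

end

theory Submission
  imports Defs "HOL-Number_Theory.Residues"
begin

text \<open>
  A vertex \<open>B\<close> is a line (a one-dimensional subspace) iff no other vertex has a neighbourhood
  containing that of \<open>B\<close>, because \<open>v\<^sup>\<bottom>\<close> is adjacent to a vertex \<open>C\<close> only if \<open>C = \<langle>v\<rangle>\<close>. Hence an
  isomorphism preserves the number \<open>N\<close> of lines and the number \<open>M\<close> of lines adjacent to a given line.
  With \<open>n = 2\<nu>\<close>, counting nonzero vectors gives \<open>(q - 1) N = q\<^sup>n - 1\<close> and
  \<open>(q - 1) M = q\<^bsup>n-1\<^esup> - 1\<close>, so \<open>N = q M + 1\<close> determines \<open>q\<close>, and then \<open>q\<^sup>n\<close> determines \<open>\<nu>\<close>.

  Conversely, finite fields of the same order are isomorphic, and a field isomorphism applied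
  coordinatewise preserves subspaces and the symplectic form. For the isomorphism of fields of
  order \<open>q\<close> and characteristic \<open>p\<close>, let \<open>g\<close> generate the multiplicative group of the first and let \<open>m\<close> be
  a monic integer polynomial of least degree with \<open>m(g) = 0\<close>. The integer polynomials
  vanishing at \<open>g\<close> are the multiples of \<open>m\<close> modulo \<open>p\<close>. In particular \<open>m\<close> divides \<open>X\<^sup>q - X\<close> modulo \<open>p\<close>,
  so \<open>m\<close> has a root \<open>y\<close> in the second field, and \<open>f(g) \<mapsto> f(y)\<close> is well defined.
\<close>

section \<open>Finite fields of equal order\<close>

hide_const (open) UnivPoly.monom UnivPoly.coeff Module.smult

text \<open>Integer polynomials play the role of polynomials over the prime field: one and the same
  polynomial can be evaluated in both fields.\<close>

abbreviation int_poly_eval :: "'a::comm_ring_1 \<Rightarrow> int poly \<Rightarrow> 'a" where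
  "int_poly_eval x f \<equiv> poly (map_poly of_int f) x"

section \<open>Compatibility of coefficient reduction with polynomial arithmetic\<close>

lemma map_poly_of_int_add:
  "map_poly of_int (f + g) = (map_poly of_int f + map_poly of_int g :: 'a::comm_ring_1 poly)"
  by (rule poly_eqI) (simp add: coeff_map_poly)

lemma map_poly_of_int_diff:
  "map_poly of_int (f - g) = (map_poly of_int f - map_poly of_int g :: 'a::comm_ring_1 poly)"
  by (rule poly_eqI) (simp add: coeff_map_poly)

lemma map_poly_of_int_mult:
  "map_poly of_int (f * g) = (map_poly of_int f * map_poly of_int g :: 'a::comm_ring_1 poly)"
  by (rule poly_eqI) (simp add: coeff_map_poly coeff_mult)

lemma map_poly_of_int_monom:
  "map_poly of_int (monom c k) = (monom (of_int c) k :: 'a::comm_ring_1 poly)"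
  by (rule poly_eqI) (simp add: coeff_map_poly)

lemmas map_poly_of_int_simps =
  map_poly_of_int_add map_poly_of_int_diff map_poly_of_int_mult map_poly_of_int_monom

lemma finite_field_generator:
  "\<exists>g :: 'a::{field,finite}. \<forall>x. x \<noteq> 0 \<longrightarrow> (\<exists>i::nat. x = g ^ i)"
proof -
  have pow: "x [^]\<^bsub>class_ring\<^esub> i = x ^ i" for x :: 'a and i :: nat
    by (induction i) (auto simp: class_ring_simps)
  have "\<exists>a \<in> carrier (mult_of (class_ring :: 'a ring)).
      carrier (mult_of (class_ring :: 'a ring)) = {a [^]\<^bsub>class_ring\<^esub> i | i::nat. i \<in> UNIV}"
    by (rule field.finite_field_mult_group_has_gen[OF class_field]) (simp add: class_ring_simps)
  then obtain a :: 'a where "carrier (mult_of (class_ring :: 'a ring)) = {a ^ i | i::nat. i \<in> UNIV}"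
    unfolding pow by blast
  then have "UNIV - {0} = {a ^ i | i::nat. i \<in> UNIV}"
    by (simp add: class_ring_simps)
  then show ?thesis by (intro exI[of _ a]) blast
qed

text \<open>Multiplication by a nonzero \<open>x\<close> permutes the nonzero elements. Comparing
  their product before and after gives \<open>x ^ (CARD('a) - 1) = 1\<close>.\<close>

lemma finite_field_power_CARD:
  fixes x :: "'a::{field,finite}"
  shows "x ^ CARD('a) = x"
proof (cases "x = 0")
  case False
  have "bij_betw ((*) x) (UNIV - {0}) (UNIV - {0})"
    using False by (intro bij_betwI[of _ _ _ "\<lambda>y. y / x"]) auto
  then have "(\<Prod>y\<in>UNIV - {0}. x * y) = \<Prod>(UNIV - {0})"
    by (rule prod.reindex_bij_betw)
  then have "x ^ (CARD('a) - 1) * \<Prod>(UNIV - {0}) = 1 * \<Prod>(UNIV - {0})"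
    by (simp add: prod.distrib card_Diff_subset)
  then have "x ^ (CARD('a) - 1) = 1"
    by (subst (asm) mult_right_cancel) auto
  moreover have "x ^ CARD('a) = x * x ^ (CARD('a) - 1)"
    by (simp flip: power_Suc)
  ultimately show ?thesis by simp
qed (simp add: zero_power)

lemma CHAR_eq_of_CARD_prime_power:
  assumes "prime p" "CARD('a::{field,finite}) = p ^ k"
  shows "CHAR('a) = p"
proof -
  have "prime CHAR('a)" by (rule prime_CHAR_semidom) (simp add: finite_imp_CHAR_pos)
  moreover have "CHAR('a) dvd p ^ k" using CHAR_dvd_CARD[where 'a='a] assms(2) by simp
  ultimately show ?thesis using assms(1) prime_dvd_power primes_dvd_imp_eq by blast
qed

text \<open>By minimality of \<open>d\<close>, the leading coefficient of \<open>r\<close> is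
  divisible by the characteristic, so the leading term is zero in both fields. Dropping it keeps the
  relation at \<open>g\<close> and lowers the degree, and induction removes all terms.\<close>

lemma low_degree_relation_trivial:
  fixes g :: "'a::field"
  assumes p: "prime CHAR('a)" and ch: "CHAR('b::field) = CHAR('a)"
    and min: "\<And>m. lead_coeff m = 1 \<Longrightarrow> int_poly_eval g m = 0 \<Longrightarrow> d \<le> degree m"
    and "int_poly_eval g r = 0" "degree r < d"
  shows "map_poly of_int r = (0 :: 'b poly)"
  using assms(4,5)
proof (induction "degree r" arbitrary: r rule: less_induct)
  case (less r)
  define k c where "k = degree r" and "c = lead_coeff r"
  have dvd: "int CHAR('a) dvd c"
  proof (rule ccontr)
    \<comment> \<open>If \<open>c\<close> is invertible modulo the characteristic, rescaling \<open>r\<close> makes it monic.\<close>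
    assume "\<not> int CHAR('a) dvd c"
    then have "coprime (int CHAR('a)) c" using p by (intro prime_imp_coprime) auto
    then obtain u v where uv: "u * int CHAR('a) + v * c = 1"
      by (metis bezout_int coprime_iff_gcd_eq_1)
    \<comment> \<open>The second summand vanishes in the field and corrects the leading coefficient
      to exactly 1 over the integers.\<close>
    define m where "m = monom v 0 * r + monom (u * int CHAR('a)) k"
    have cm: "coeff m k = 1"
      using uv unfolding m_def c_def k_def by (simp add: monom_0)
    have "degree m \<le> k"
      unfolding m_def k_def by (intro degree_add_le) (auto simp: monom_0 degree_monom_le)
    with cm have "degree m = k" by (metis le_antisym le_degree one_neq_zero)
    moreover have "int_poly_eval g m = 0"
      using less.prems unfolding m_def by (simp add: map_poly_of_int_simps poly_monom)
    ultimately show False using min[of m] cm less.prems unfolding k_def by simp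
  qed
  show ?case
  proof (cases "k = 0")
    case True
    then have "r = monom c 0" unfolding k_def c_def by (auto simp: monom_0 dest: degree_0_id)
    with dvd ch show ?thesis by (simp add: map_poly_of_int_simps of_int_eq_0_iff_char_dvd)
  next
    case False
    define r' where "r' = r - monom c k"
    have "coeff r' k = 0" unfolding r'_def c_def k_def by simp
    moreover have "degree r' \<le> k"
      unfolding r'_def k_def by (intro degree_diff_le) (auto simp: degree_monom_le)
    ultimately have "degree r' < k" using False
      by (metis le_neq_implies_less leading_coeff_0_iff degree_0)
    moreover have "int_poly_eval g r' = 0"
      using less.prems dvd unfolding r'_def
      by (simp add: map_poly_of_int_simps of_int_eq_0_iff_char_dvd poly_monom)
    ultimately have "map_poly of_int r' = (0 :: 'b poly)"
      using less.prems(2) by (intro less.hyps) (auto simp: k_def)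
    then show ?thesis using dvd ch unfolding r'_def
      by (simp add: map_poly_of_int_simps of_int_eq_0_iff_char_dvd)
  qed
qed

lemma finite_field_root_transfer:
  fixes g :: "'a::{field,finite}"
  assumes card: "CARD('a) = CARD('b::{field,finite})" and ch: "CHAR('b) = CHAR('a)"
  obtains y :: "'b::{field,finite}" where "\<And>f. int_poly_eval g f = 0 \<Longrightarrow> int_poly_eval y f = 0"
proof -
  let ?q = "CARD('a)" and ?rel = "\<lambda>m. lead_coeff m = 1 \<and> int_poly_eval g m = 0"
  \<comment> \<open>Every element of either field is a root of \<open>X\<close>. Being monic,
    \<open>X\<close> also shows that some monic polynomial vanishes at \<open>g\<close>.\<close>
  define X where "X = (monom 1 ?q - monom 1 1 :: int poly)"
  have p: "prime CHAR('a)" by (rule prime_CHAR_semidom) (simp add: finite_imp_CHAR_pos)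
  have q: "?q > 1" using card_mono[of UNIV "{0, 1 :: 'a}"] by simp
  have "degree X \<le> ?q"
    unfolding X_def using q by (intro degree_diff_le) (auto simp: degree_monom_eq)
  moreover have "coeff X ?q = 1" unfolding X_def using q by simp
  ultimately have "?rel X"
    using finite_field_power_CARD[of g] le_degree[of X ?q] unfolding X_def
    by (auto simp: map_poly_of_int_simps poly_monom)
  then obtain m where m: "?rel m" and min: "\<And>m'. ?rel m' \<Longrightarrow> degree m \<le> degree m'"
    using ex_has_least_nat[of ?rel X degree] by blast
  let ?M = "map_poly of_int m :: 'b poly"
  have factor: "\<exists>s. map_poly of_int f = ?M * s" if f: "int_poly_eval g f = 0" for f
  proof -
    \<comment> \<open>Since \<open>m\<close> is monic, pseudo-division over the integers is ordinary
      division, with no scaling of \<open>f\<close>.\<close>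
    obtain s r where sr: "pseudo_divmod f m = (s, r)" by fastforce
    have m0: "m \<noteq> 0" using m by auto
    have f_eq: "f = m * s + r" using pseudo_divmod(1)[OF m0 sr] m by simp
    have "map_poly of_int r = (0 :: 'b poly)"
    proof (cases "r = 0")
      case False
      then have "degree r < degree m" using pseudo_divmod(2)[OF m0 sr] by simp
      moreover have "int_poly_eval g r = 0"
        using f m unfolding f_eq by (simp add: map_poly_of_int_simps)
      ultimately show ?thesis
        using min by (intro low_degree_relation_trivial[OF p ch, of g "degree m"]) auto
    qed simp
    then show ?thesis unfolding f_eq by (auto simp: map_poly_of_int_simps)
  qed
  have M: "coeff ?M (degree m) = 1" using m by (simp add: coeff_map_poly)
  \<comment> \<open>A monic constant is 1, which does not vanish at \<open>g\<close>. The positive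
    degree is what leaves the cofactor \<open>S\<close> fewer roots than the field has
    elements.\<close>
  have "degree m \<noteq> 0"
  proof
    assume "degree m = 0"
    then have "m = 1" using m by (metis degree_0_id one_pCons)
    then show False using m by simp
  qed
  then have dM: "degree ?M > 0" using le_degree[of ?M "degree m"] M by simp
  obtain S where S: "map_poly of_int X = ?M * S" using factor \<open>?rel X\<close> by blast
  have X': "coeff (map_poly of_int X :: 'b poly) ?q = 1"
    using \<open>coeff X ?q = 1\<close> by (simp add: coeff_map_poly)
  have X0: "map_poly of_int X \<noteq> (0 :: 'b poly)" using X' by (metis coeff_0 zero_neq_one)
  have "degree (map_poly of_int X :: 'b poly) \<le> ?q"
    using \<open>degree X \<le> ?q\<close> by (intro degree_le) (auto simp: coeff_map_poly coeff_eq_0)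
  moreover have "S \<noteq> 0" using X0 S by auto
  moreover have "degree (?M * S) = degree ?M + degree S"
    using X0 unfolding S by (intro degree_mult_eq) auto
  ultimately have "degree S < CARD('b)" using dM card unfolding S by linarith
  moreover have "card {x. poly S x = 0} \<le> degree S"
    using \<open>S \<noteq> 0\<close> by (rule card_poly_roots_bound)
  ultimately have "{x. poly S x = 0} \<noteq> UNIV" by auto
  \<comment> \<open>Every element is a root of \<open>X\<close>, so a non-root of the cofactor \<open>S\<close> is a root of \<open>?M\<close>.\<close>
  then obtain y where y: "poly S y \<noteq> 0" by blast
  have "poly ?M y * poly S y = int_poly_eval y X" unfolding S by simp
  also have "\<dots> = 0" using finite_field_power_CARD[of y] card unfolding X_def
    by (simp add: map_poly_of_int_simps poly_monom)
  finally have "poly ?M y = 0" using y by simp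
  then show thesis using that[of y] factor by fastforce
qed

lemma finite_fields_isomorphic:
  assumes "primepow CARD('a)" "CARD('a::{field,finite}) = CARD('b::{field,finite})"
  obtains \<phi> :: "'a::{field,finite} \<Rightarrow> 'b::{field,finite}" where "field_hom \<phi>" "bij \<phi>"
proof -
  obtain p k where "prime p" "CARD('a) = p ^ k" using assms(1) by (auto simp: primepow_def)
  then have ch: "CHAR('b) = CHAR('a)" using CHAR_eq_of_CARD_prime_power assms(2) by metis
  obtain g :: 'a where g: "\<And>x. x \<noteq> 0 \<Longrightarrow> \<exists>i::nat. x = g ^ i"
    using finite_field_generator by blast
  obtain y :: 'b where y: "\<And>f. int_poly_eval g f = 0 \<Longrightarrow> int_poly_eval y f = 0"
    using finite_field_root_transfer[OF assms(2) ch] by blast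
  have "\<exists>f. int_poly_eval g f = x" for x
  proof (cases "x = 0")
    case True
    then show ?thesis by (intro exI[of _ 0]) simp
  next
    case False
    then obtain i where "x = g ^ i" using g by blast
    then show ?thesis by (intro exI[of _ "monom 1 i"]) (simp add: map_poly_of_int_simps poly_monom)
  qed
  then obtain F where F: "\<And>x. int_poly_eval g (F x) = x" by metis
  define \<phi> where "\<phi> x = int_poly_eval y (F x)" for x
  \<comment> \<open>Well-definedness: \<open>f\<close> and the chosen representative of its value
    differ by a polynomial vanishing at \<open>g\<close>, hence also at \<open>y\<close>.\<close>
  have \<phi>: "\<phi> (int_poly_eval g f) = int_poly_eval y f" for f
    using y[of "F (int_poly_eval g f) - f"] unfolding \<phi>_def by (simp add: map_poly_of_int_simps F)
  have "\<phi> 0 = 0" "\<phi> 1 = 1" using \<phi>[of 0] \<phi>[of 1] by auto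
  moreover have "\<phi> (x + z) = \<phi> x + \<phi> z" "\<phi> (x * z) = \<phi> x * \<phi> z" for x z
    using \<phi>[of "F x + F z"] \<phi>[of "F x * F z"] by (simp_all add: map_poly_of_int_simps F \<phi>_def)
  ultimately interpret field_hom \<phi> by unfold_locales auto
  have "inj \<phi>" by (rule injI) simp
  then have "bij \<phi>" unfolding bij_def
    using assms(2) card_image[of \<phi> UNIV] card_subset_eq[of UNIV "range \<phi>"] by simp
  with field_hom_axioms show thesis by (rule that)
qed

section \<open>Subspaces and the symplectic form\<close>

text \<open>An elementwise form of the library notion, convenient for lines, complements and images
  under coordinatewise maps.\<close>

definition vec_subspace :: "nat \<Rightarrow> 'a::field vec set \<Rightarrow> bool" where
  "vec_subspace n W \<longleftrightarrow> W \<subseteq> carrier_vec n \<and> 0\<^sub>v n \<in> W \<and>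
     (\<forall>v\<in>W. \<forall>w\<in>W. v + w \<in> W) \<and> (\<forall>c. \<forall>v\<in>W. c \<cdot>\<^sub>v v \<in> W)"

lemma subspace_iff_vec_subspace:
  "VectorSpace.subspace class_ring W (module_vec TYPE('a::field) n) \<longleftrightarrow> vec_subspace n W"
  unfolding VectorSpace.subspace_def submodule_def vec_subspace_def
  using vec_module[where 'a='a and n=n] vec_vs[where 'a='a and n=n]
  by (auto simp: module_vec_simps class_ring_simps)

lemma Spi_verts_iff:
  "W \<in> Spi_verts TYPE('a::field) \<nu> \<longleftrightarrow>
     vec_subspace (2 * \<nu>) W \<and> W \<noteq> {0\<^sub>v (2 * \<nu>)} \<and> W \<noteq> carrier_vec (2 * \<nu>)"
  by (simp add: Spi_verts_def subspace_iff_vec_subspace)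

section \<open>Bilinearity and nondegeneracy of the form\<close>

lemma symplectic_form_add_left:
  assumes "a \<in> carrier_vec (2 * \<nu>)" "b \<in> carrier_vec (2 * \<nu>)" "c \<in> carrier_vec (2 * \<nu>)"
  shows "symplectic_form \<nu> (a + b) c = symplectic_form \<nu> a c + symplectic_form \<nu> b c"
  unfolding symplectic_form_def
  using assms mult_mat_vec_carrier[OF symplectic_mat_carrier assms(3)]
  by (simp add: add_scalar_prod_distrib)

lemma symplectic_form_add_right:
  assumes "a \<in> carrier_vec (2 * \<nu>)" "b \<in> carrier_vec (2 * \<nu>)" "c \<in> carrier_vec (2 * \<nu>)"
  shows "symplectic_form \<nu> a (b + c) = symplectic_form \<nu> a b + symplectic_form \<nu> a c"
  unfolding symplectic_form_def
  using assms mult_mat_vec_carrier[OF symplectic_mat_carrier assms(2)]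
    mult_mat_vec_carrier[OF symplectic_mat_carrier assms(3)]
  by (simp add: mult_add_distrib_mat_vec[OF symplectic_mat_carrier] scalar_prod_add_distrib)

lemma symplectic_form_smult_left:
  assumes "a \<in> carrier_vec (2 * \<nu>)" "b \<in> carrier_vec (2 * \<nu>)"
  shows "symplectic_form \<nu> (t \<cdot>\<^sub>v a) b = t * symplectic_form \<nu> a b"
  unfolding symplectic_form_def
  using assms mult_mat_vec_carrier[OF symplectic_mat_carrier assms(2)] by simp

lemma symplectic_form_smult_right:
  assumes "a \<in> carrier_vec (2 * \<nu>)" "b \<in> carrier_vec (2 * \<nu>)"
  shows "symplectic_form \<nu> a (t \<cdot>\<^sub>v b) = t * symplectic_form \<nu> a b"
  unfolding symplectic_form_def
  using assms mult_mat_vec_carrier[OF symplectic_mat_carrier assms(2)]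
  by (simp add: mult_mat_vec[OF symplectic_mat_carrier])

lemmas symplectic_form_bilinear =
  symplectic_form_add_left symplectic_form_add_right
  symplectic_form_smult_left symplectic_form_smult_right

text \<open>As \<open>K * K = -1\<close>, pairing \<open>a\<close> with \<open>K\<close> applied to
  the \<open>i\<close>-th unit vector yields minus the \<open>i\<close>-th coordinate of
  \<open>a\<close>.\<close>

lemma symplectic_form_nondegenerate:
  fixes a :: "'a::field vec"
  assumes a: "a \<in> carrier_vec (2 * \<nu>)"
    and 0: "\<And>b. b \<in> carrier_vec (2 * \<nu>) \<Longrightarrow> symplectic_form \<nu> a b = 0"
  shows "a = 0\<^sub>v (2 * \<nu>)"
proof -
  let ?K = "symplectic_mat \<nu> :: 'a mat"
  have K: "?K \<in> carrier_mat (2 * \<nu>) (2 * \<nu>)" by simp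
  have KK: "?K * ?K = - 1\<^sub>m (2 * \<nu>)"
  proof -
    have "?K * ?K = four_block_mat (- 1\<^sub>m \<nu>) (0\<^sub>m \<nu> \<nu>) (0\<^sub>m \<nu> \<nu>) (- 1\<^sub>m \<nu>)"
      unfolding symplectic_mat_def by (subst mult_four_block_mat[of _ \<nu> \<nu> _ \<nu> _ \<nu> _ _ \<nu> _ \<nu>]) auto
    also have "\<dots> = - 1\<^sub>m (2 * \<nu>)" by (rule eq_matI) auto
    finally show ?thesis .
  qed
  have "a $ i = 0" if i: "i < 2 * \<nu>" for i
  proof -
    let ?e = "unit_vec (2 * \<nu>) i"
    have "?K *\<^sub>v (?K *\<^sub>v ?e) = - ?e"
      using assoc_mult_mat_vec[OF K K, of ?e] by (simp add: KK)
    then have "- (a $ i) = symplectic_form \<nu> a (?K *\<^sub>v ?e)"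
      unfolding symplectic_form_def using a i by simp
    also have "\<dots> = 0" by (intro 0 mult_mat_vec_carrier[OF K]) simp
    finally show ?thesis by simp
  qed
  then show ?thesis using a by (intro eq_vecI) auto
qed

section \<open>Lines and their orthogonal complements\<close>

definition vec_line :: "'a::field vec \<Rightarrow> 'a vec set" where
  "vec_line v = range (\<lambda>c. c \<cdot>\<^sub>v v)"

definition vec_lines :: "nat \<Rightarrow> 'a::field vec set \<Rightarrow> 'a vec set set" where
  "vec_lines n W = vec_line ` (W - {0\<^sub>v n})"

definition vec_perp :: "nat \<Rightarrow> 'a::field vec \<Rightarrow> 'a vec set" where
  "vec_perp \<nu> v = {x \<in> carrier_vec (2 * \<nu>). symplectic_form \<nu> v x = 0}"

lemma vec_line_self: "v \<in> vec_line v"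
  unfolding vec_line_def by (rule range_eqI[of _ _ 1]) simp

lemma vec_subspace_line:
  assumes "v \<in> carrier_vec n"
  shows "vec_subspace n (vec_line v)"
proof -
  have "0\<^sub>v n = 0 \<cdot>\<^sub>v v" using assms by auto
  then show ?thesis unfolding vec_subspace_def vec_line_def using assms
    by (auto simp: smult_smult_assoc simp flip: add_smult_distrib_vec)
qed

lemma vec_line_subset_iff:
  assumes "vec_subspace n W"
  shows "vec_line v \<subseteq> W \<longleftrightarrow> v \<in> W"
  using assms vec_line_self[of v] unfolding vec_subspace_def vec_line_def by auto

text \<open>The factor relating \<open>w\<close> to \<open>v\<close> is nonzero, hence invertible.
  Distinct lines therefore meet only in zero.\<close>

lemma vec_line_eqI:
  assumes "v \<in> carrier_vec n" "w \<in> vec_line v" "w \<noteq> 0\<^sub>v n"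
  shows "vec_line w = vec_line v"
proof
  show "vec_line w \<subseteq> vec_line v"
    using assms(2) vec_line_subset_iff vec_subspace_line[OF assms(1)] by blast
  obtain c where c: "w = c \<cdot>\<^sub>v v" using assms(2) by (auto simp: vec_line_def)
  with assms have "c \<noteq> 0" by auto
  then have "v = inverse c \<cdot>\<^sub>v w" unfolding c by (simp add: smult_smult_assoc)
  then have "v \<in> vec_line w" by (auto simp: vec_line_def)
  moreover have "w \<in> carrier_vec n" using c assms(1) by simp
  ultimately show "vec_line v \<subseteq> vec_line w"
    using vec_line_subset_iff vec_subspace_line by blast
qed

section \<open>Counting vectors and lines\<close>

lemma card_vec_line:
  fixes v :: "'a::{field,finite} vec"
  assumes "v \<in> carrier_vec n" "v \<noteq> 0\<^sub>v n"
  shows "card (vec_line v) = CARD('a)"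
  unfolding vec_line_def
proof (rule card_image, rule injI)
  fix c d assume eq: "c \<cdot>\<^sub>v v = d \<cdot>\<^sub>v v"
  obtain i where "i < n" "v $ i \<noteq> 0" using assms by (metis carrier_vecD eq_vecI index_zero_vec)
  then show "c = d" using assms(1) arg_cong[OF eq, of "\<lambda>x. x $ i"] by simp
qed

lemma card_carrier_vec: "card (carrier_vec n :: 'a::finite vec set) = CARD('a) ^ n"
proof -
  have "bij_betw vec_of_list {xs :: 'a list. set xs \<subseteq> UNIV \<and> length xs = n} (carrier_vec n)"
    by (rule bij_betwI[of _ _ _ list_of_vec]) (auto simp: list_vec vec_list intro: carrier_vecI)
  from bij_betw_same_card[OF this] show ?thesis
    using card_lists_length_eq[of "UNIV :: 'a set" n] by simp
qed

text \<open>The lines without zero partition the nonzero vectors of \<open>W\<close> into blocks of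
  \<open>CARD('a) - 1\<close> elements.\<close>

lemma card_vec_lines:
  fixes W :: "'a::{field,finite} vec set"
  assumes W: "vec_subspace n W"
  shows "(CARD('a) - 1) * card (vec_lines n W) + 1 = card W"
proof -
  have WC: "W \<subseteq> carrier_vec n" and W0: "0\<^sub>v n \<in> W" using W by (auto simp: vec_subspace_def)
  have fin: "finite W" using WC finite_carrier_vec by (rule finite_subset)
  let ?P = "(\<lambda>l. l - {0\<^sub>v n}) ` vec_lines n W"
  have un: "\<Union> ?P = W - {0\<^sub>v n}"
    using vec_line_self vec_line_subset_iff[OF W] by (auto simp: vec_lines_def)
  \<comment> \<open>Counting blocks instead of lines is harmless: putting zero back recovers the
    line.\<close>
  have "inj_on (\<lambda>l. l - {0\<^sub>v n}) (vec_lines n W)"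
  proof (rule inj_on_inverseI[of _ "insert (0\<^sub>v n)"])
    fix l assume "l \<in> vec_lines n W"
    then have "0\<^sub>v n \<in> l"
      using WC vec_subspace_line by (auto simp: vec_lines_def vec_subspace_def)
    then show "insert (0\<^sub>v n) (l - {0\<^sub>v n}) = l" by auto
  qed
  then have "card ?P = card (vec_lines n W)" by (rule card_image)
  moreover have "(CARD('a) - 1) * card ?P = card (\<Union> ?P)"
  proof (rule card_partition)
    show "finite ?P" using fin by (simp add: vec_lines_def)
    show "finite (\<Union> ?P)" using fin un by simp
    show "card c = CARD('a) - 1" if "c \<in> ?P" for c
    proof -
      from that obtain v where v: "v \<in> W" "v \<noteq> 0\<^sub>v n" "c = vec_line v - {0\<^sub>v n}"
        by (auto simp: vec_lines_def)
      have vC: "v \<in> carrier_vec n" using v WC by auto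
      have "0\<^sub>v n \<in> vec_line v" using vec_subspace_line[OF vC] by (simp add: vec_subspace_def)
      then show ?thesis using card_vec_line[OF vC v(2)] v(3) by simp
    qed
    show "c \<inter> d = {}" if cd: "c \<in> ?P" "d \<in> ?P" "c \<noteq> d" for c d
    proof (rule ccontr)
      assume "c \<inter> d \<noteq> {}"
      then obtain x where x: "x \<in> c" "x \<in> d" by blast
      obtain v w where "v \<in> W" "c = vec_line v - {0\<^sub>v n}" "w \<in> W" "d = vec_line w - {0\<^sub>v n}"
        using cd by (auto simp: vec_lines_def)
      with x have "vec_line x = vec_line v" "vec_line x = vec_line w"
        using vec_line_eqI WC by blast+
      with \<open>c = _\<close> \<open>d = _\<close> cd(3) show False by simp
    qed
  qed
  moreover have "card W = card (W - {0\<^sub>v n}) + 1"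
    using card.remove[OF fin W0] by simp
  ultimately show ?thesis using un by simp
qed

section \<open>The orthogonal complement of a vector\<close>

lemma vec_subspace_carrier: "vec_subspace n (carrier_vec n)"
  by (simp add: vec_subspace_def)

lemma vec_subspace_perp:
  fixes v :: "'a::field vec"
  assumes "v \<in> carrier_vec (2 * \<nu>)"
  shows "vec_subspace (2 * \<nu>) (vec_perp \<nu> v)"
proof -
  have "0 \<cdot>\<^sub>v 0\<^sub>v (2 * \<nu>) = (0\<^sub>v (2 * \<nu>) :: 'a vec)" by (rule eq_vecI) auto
  then have "symplectic_form \<nu> v (0\<^sub>v (2 * \<nu>)) = 0"
    using symplectic_form_smult_right[OF assms zero_carrier_vec, of 0] by simp
  then show ?thesis unfolding vec_subspace_def vec_perp_def using assms
    by (auto simp: symplectic_form_bilinear)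
qed

lemma symplectic_form_witness:
  assumes "v \<in> carrier_vec (2 * \<nu>)" "v \<noteq> 0\<^sub>v (2 * \<nu>)"
  obtains x where "x \<in> carrier_vec (2 * \<nu>)" "symplectic_form \<nu> v x = 1"
proof -
  obtain y where y: "y \<in> carrier_vec (2 * \<nu>)" "symplectic_form \<nu> v y \<noteq> 0"
    using symplectic_form_nondegenerate assms by blast
  show thesis
    using y assms by (intro that[of "inverse (symplectic_form \<nu> v y) \<cdot>\<^sub>v y"])
      (auto simp: symplectic_form_bilinear)
qed

text \<open>Choose \<open>x0\<close> pairing to 1 with \<open>v\<close>. Every \<open>b\<close> is
  an element of the complement of \<open>v\<close> plus a multiple of \<open>x0\<close>. With
  \<open>t\<close> the pairing of \<open>c\<close> and \<open>x0\<close>, the vector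
  \<open>c - t v\<close> is orthogonal to both parts, so it is zero by nondegeneracy.\<close>

lemma vec_perp_perp:
  fixes v c :: "'a::field vec"
  assumes v: "v \<in> carrier_vec (2 * \<nu>)" "v \<noteq> 0\<^sub>v (2 * \<nu>)" and c: "c \<in> carrier_vec (2 * \<nu>)"
    and perp: "\<And>x. x \<in> vec_perp \<nu> v \<Longrightarrow> symplectic_form \<nu> c x = 0"
  shows "c \<in> vec_line v"
proof -
  let ?n = "2 * \<nu>"
  obtain x0 where x0: "x0 \<in> carrier_vec ?n" "symplectic_form \<nu> v x0 = 1"
    using symplectic_form_witness[OF v] .
  define t where "t = symplectic_form \<nu> c x0"
  have "c + (- t) \<cdot>\<^sub>v v = 0\<^sub>v ?n"
  proof (rule symplectic_form_nondegenerate)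
    fix b :: "'a vec" assume b: "b \<in> carrier_vec ?n"
    let ?y = "b + (- symplectic_form \<nu> v b) \<cdot>\<^sub>v x0"
    have "?y \<in> vec_perp \<nu> v"
      unfolding vec_perp_def using b v x0 by (simp add: symplectic_form_bilinear)
    then have "symplectic_form \<nu> c ?y = 0" by (rule perp)
    then show "symplectic_form \<nu> (c + (- t) \<cdot>\<^sub>v v) b = 0"
      using b v(1) c x0 unfolding t_def by (simp add: symplectic_form_bilinear)
  qed (use v c in simp)
  then have "(c + (- t) \<cdot>\<^sub>v v) $ i = 0" if "i < ?n" for i using that by simp
  then have "c $ i = t * v $ i" if "i < ?n" for i using that v(1) c by fastforce
  then have "c = t \<cdot>\<^sub>v v" using v c by (intro eq_vecI) auto
  then show ?thesis by (auto simp: vec_line_def)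
qed

text \<open>The complement of \<open>v\<close> and the line of \<open>x0\<close> together give
  unique coordinates for the whole space; the \<open>x0\<close>-coordinate of \<open>y\<close> is
  its pairing with \<open>v\<close>.\<close>

lemma card_vec_perp:
  fixes v :: "'a::{field,finite} vec"
  assumes v: "v \<in> carrier_vec (2 * \<nu>)" "v \<noteq> 0\<^sub>v (2 * \<nu>)"
  shows "card (vec_perp \<nu> v) * CARD('a) = CARD('a) ^ (2 * \<nu>)"
proof -
  let ?n = "2 * \<nu>"
  obtain x0 where x0: "x0 \<in> carrier_vec ?n" "symplectic_form \<nu> v x0 = 1"
    using symplectic_form_witness[OF v] .
  have "bij_betw (\<lambda>(x, t). x + t \<cdot>\<^sub>v x0) (vec_perp \<nu> v \<times> UNIV) (carrier_vec ?n)"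
  proof (rule bij_betwI[of _ _ _ "\<lambda>y. (y + (- symplectic_form \<nu> v y) \<cdot>\<^sub>v x0, symplectic_form \<nu> v y)"])
    show "(\<lambda>(x, t). x + t \<cdot>\<^sub>v x0) \<in> vec_perp \<nu> v \<times> UNIV \<rightarrow> carrier_vec ?n"
      using x0 by (auto simp: vec_perp_def)
    show "(\<lambda>y. (y + (- symplectic_form \<nu> v y) \<cdot>\<^sub>v x0, symplectic_form \<nu> v y))
        \<in> carrier_vec ?n \<rightarrow> vec_perp \<nu> v \<times> UNIV"
      using x0 v by (auto simp: vec_perp_def symplectic_form_bilinear)
    fix xt assume xt: "xt \<in> vec_perp \<nu> v \<times> (UNIV :: 'a set)"
    obtain x t where [simp]: "xt = (x, t)" by fastforce
    have x: "x \<in> carrier_vec ?n" "symplectic_form \<nu> v x = 0" using xt by (auto simp: vec_perp_def)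
    have "symplectic_form \<nu> v (x + t \<cdot>\<^sub>v x0) = t"
      using x v x0 by (simp add: symplectic_form_bilinear)
    moreover have "x + t \<cdot>\<^sub>v x0 + - t \<cdot>\<^sub>v x0 = x"
      using x x0 by (intro eq_vecI) auto
    ultimately show "((case xt of (x, t) \<Rightarrow> x + t \<cdot>\<^sub>v x0) +
        - symplectic_form \<nu> v (case xt of (x, t) \<Rightarrow> x + t \<cdot>\<^sub>v x0) \<cdot>\<^sub>v x0,
        symplectic_form \<nu> v (case xt of (x, t) \<Rightarrow> x + t \<cdot>\<^sub>v x0)) = xt" by simp
  next
    fix y :: "'a vec" assume y: "y \<in> carrier_vec ?n"
    show "(case (y + (- symplectic_form \<nu> v y) \<cdot>\<^sub>v x0, symplectic_form \<nu> v y) of (x, t) \<Rightarrow> x + t \<cdot>\<^sub>v x0) = y"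
      using y x0 by (intro eq_vecI) auto
  qed
  from bij_betw_same_card[OF this] show ?thesis
    by (simp add: card_cartesian_product card_carrier_vec)
qed

section \<open>Recovering the parameters from the graph\<close>

definition Spi_nbrs :: "nat \<Rightarrow> 'a::field vec set \<Rightarrow> 'a vec set set" where
  "Spi_nbrs \<nu> A = {B. (A, B) \<in> parcs (Spi TYPE('a) \<nu>)}"

lemma Spi_nbrs_iff:
  "B \<in> Spi_nbrs \<nu> A \<longleftrightarrow> A \<in> Spi_verts TYPE('a::field) \<nu> \<and> B \<in> Spi_verts TYPE('a) \<nu> \<and>
     (\<forall>a\<in>A. \<forall>b\<in>B. symplectic_form \<nu> a b = 0)"
  by (simp add: Spi_nbrs_def Spi_def)

lemma CARD_field_ge_2: "CARD('a::{field,finite}) \<ge> 2"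
  using card_mono[of UNIV "{0, 1 :: 'a}"] by simp

context
  fixes \<nu> :: nat
  assumes \<nu>: "\<nu> \<ge> 1"
begin

lemma vec_line_vertex:
  fixes v :: "'a::{field,finite} vec"
  assumes v: "v \<in> carrier_vec (2 * \<nu>)" "v \<noteq> 0\<^sub>v (2 * \<nu>)"
  shows "vec_line v \<in> Spi_verts TYPE('a) \<nu>"
proof -
  have "CARD('a) ^ 1 < CARD('a) ^ (2 * \<nu>)"
    using CARD_field_ge_2[where 'a='a] \<nu> by (intro power_strict_increasing) auto
  then have "vec_line v \<noteq> carrier_vec (2 * \<nu>)"
    using card_vec_line[OF v] card_carrier_vec[where 'a='a, of "2 * \<nu>"] by auto
  then show ?thesis
    using v vec_line_self[of v] vec_subspace_line[OF v(1)] by (auto simp: Spi_verts_iff)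
qed

lemma vec_perp_vertex:
  fixes v :: "'a::{field,finite} vec"
  assumes v: "v \<in> carrier_vec (2 * \<nu>)" "v \<noteq> 0\<^sub>v (2 * \<nu>)"
  shows "vec_perp \<nu> v \<in> Spi_verts TYPE('a) \<nu>"
proof -
  \<comment> \<open>The dimension is at least 2, so a one-element complement would contradict
    \<open>card_vec_perp\<close>.\<close>
  have "CARD('a) ^ 1 < CARD('a) ^ (2 * \<nu>)"
    using CARD_field_ge_2[where 'a='a] \<nu> by (intro power_strict_increasing) auto
  then have "vec_perp \<nu> v \<noteq> {0\<^sub>v (2 * \<nu>)}"
    using card_vec_perp[OF v] by auto
  moreover have "vec_perp \<nu> v \<noteq> carrier_vec (2 * \<nu>)"
    using symplectic_form_witness[OF v] unfolding vec_perp_def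
    by (metis (mono_tags, lifting) mem_Collect_eq zero_neq_one)
  ultimately show ?thesis using vec_subspace_perp[OF v(1)] by (simp add: Spi_verts_iff)
qed

text \<open>A vertex adjacent to the complement lies in the double complement, the line of
  \<open>v\<close>, and a nonzero subspace of a line is the whole line.\<close>

lemma vec_perp_nbr_iff:
  fixes v :: "'a::{field,finite} vec"
  assumes v: "v \<in> carrier_vec (2 * \<nu>)" "v \<noteq> 0\<^sub>v (2 * \<nu>)" and C: "C \<in> Spi_verts TYPE('a) \<nu>"
  shows "vec_perp \<nu> v \<in> Spi_nbrs \<nu> C \<longleftrightarrow> C = vec_line v"
proof
  assume "vec_perp \<nu> v \<in> Spi_nbrs \<nu> C"
  then have sub: "C \<subseteq> vec_line v"
    using vec_perp_perp[OF v] Spi_verts_carrier[OF C] by (auto simp: Spi_nbrs_iff)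
  have C': "vec_subspace (2 * \<nu>) C" "C \<noteq> {0\<^sub>v (2 * \<nu>)}" using C by (auto simp: Spi_verts_iff)
  then obtain c where c: "c \<in> C" "c \<noteq> 0\<^sub>v (2 * \<nu>)" by (auto simp: vec_subspace_def)
  then have "vec_line c = vec_line v" using vec_line_eqI[OF v(1)] sub by blast
  then show "C = vec_line v" using sub c(1) vec_line_subset_iff[OF C'(1)] by blast
next
  assume "C = vec_line v"
  then show "vec_perp \<nu> v \<in> Spi_nbrs \<nu> C"
    using v vec_line_vertex[OF v] vec_perp_vertex[OF v]
    by (auto simp: Spi_nbrs_iff vec_line_def vec_perp_def symplectic_form_bilinear)
qed

text \<open>The right-hand side mentions only vertices and adjacency, so isomorphisms preserve it. A
  line qualifies because its neighbour \<open>vec_perp\<close> singles it out. Conversely, any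
  vertex contains a line, and passing to a smaller subspace enlarges the neighbourhood, so a maximal
  vertex equals that line.\<close>

lemma vec_lines_eq_maximal_nbrs:
  "vec_lines (2 * \<nu>) (carrier_vec (2 * \<nu>)) = {B \<in> Spi_verts TYPE('a::{field,finite}) \<nu>.
     \<forall>C \<in> Spi_verts TYPE('a) \<nu>. Spi_nbrs \<nu> B \<subseteq> Spi_nbrs \<nu> C \<longrightarrow> C = B}" (is "?L = ?R")
proof (intro equalityI subsetI)
  fix B assume "B \<in> ?L"
  then obtain v :: "'a vec" where v: "v \<in> carrier_vec (2 * \<nu>)" "v \<noteq> 0\<^sub>v (2 * \<nu>)" and B: "B = vec_line v"
    by (auto simp: vec_lines_def)
  have "vec_perp \<nu> v \<in> Spi_nbrs \<nu> B"
    using vec_perp_nbr_iff[OF v vec_line_vertex[OF v]] B by simp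
  then show "B \<in> ?R" using vec_perp_nbr_iff[OF v] vec_line_vertex[OF v] B by blast
next
  fix B assume B: "B \<in> ?R"
  then have B': "vec_subspace (2 * \<nu>) B" "B \<noteq> {0\<^sub>v (2 * \<nu>)}" by (auto simp: Spi_verts_iff)
  then obtain v where v: "v \<in> B" "v \<noteq> 0\<^sub>v (2 * \<nu>)" by (auto simp: vec_subspace_def)
  have vC: "v \<in> carrier_vec (2 * \<nu>)" using v B' by (auto simp: vec_subspace_def)
  have sub: "vec_line v \<subseteq> B" using vec_line_subset_iff[OF B'(1)] v by simp
  have "Spi_nbrs \<nu> B \<subseteq> Spi_nbrs \<nu> (vec_line v)"
  proof
    fix x assume "x \<in> Spi_nbrs \<nu> B"
    then show "x \<in> Spi_nbrs \<nu> (vec_line v)"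
      using vec_line_vertex[OF vC v(2)] sub unfolding Spi_nbrs_iff by blast
  qed
  then have "B = vec_line v" using B vec_line_vertex[OF vC v(2)] by blast
  then show "B \<in> ?L" using vC v(2) by (auto simp: vec_lines_def)
qed

text \<open>This turns a quantity read off the graph, the lines adjacent to a line, into a set that
  \<open>card_vec_lines\<close> and \<open>card_vec_perp\<close> can count.\<close>

lemma vec_lines_nbrs:
  fixes v :: "'a::{field,finite} vec"
  assumes v: "v \<in> carrier_vec (2 * \<nu>)" "v \<noteq> 0\<^sub>v (2 * \<nu>)"
  shows "vec_lines (2 * \<nu>) (carrier_vec (2 * \<nu>)) \<inter> Spi_nbrs \<nu> (vec_line v) =
    vec_lines (2 * \<nu>) (vec_perp \<nu> v)" (is "?L = ?R")
proof -
  have *: "vec_line w \<in> Spi_nbrs \<nu> (vec_line v) \<longleftrightarrow> w \<in> vec_perp \<nu> v"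
    if w: "w \<in> carrier_vec (2 * \<nu>)" "w \<noteq> 0\<^sub>v (2 * \<nu>)" for w
    using vec_line_vertex[OF v] vec_line_vertex[OF w] vec_line_self[of v] vec_line_self[of w] v w
    by (auto simp: Spi_nbrs_iff vec_line_def vec_perp_def symplectic_form_bilinear)
  have sub: "vec_perp \<nu> v \<subseteq> carrier_vec (2 * \<nu>)" by (auto simp: vec_perp_def)
  show ?thesis
  proof (intro equalityI subsetI)
    fix l assume "l \<in> ?L"
    then obtain w where "w \<in> carrier_vec (2 * \<nu>)" "w \<noteq> 0\<^sub>v (2 * \<nu>)" "l = vec_line w"
      "vec_line w \<in> Spi_nbrs \<nu> (vec_line v)"
      unfolding vec_lines_def by blast
    with * show "l \<in> ?R" unfolding vec_lines_def by blast
  next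
    fix l assume "l \<in> ?R"
    then obtain w where "w \<in> vec_perp \<nu> v" "w \<noteq> 0\<^sub>v (2 * \<nu>)" "l = vec_line w"
      unfolding vec_lines_def by blast
    with * sub show "l \<in> ?L" unfolding vec_lines_def by blast
  qed
qed

end

text \<open>Eliminating \<open>q ^ n\<close> gives \<open>N = q * M + 1\<close>, and likewise for
  \<open>r\<close>. As \<open>M\<close> is nonzero, \<open>q = r\<close>, and then the exponents
  agree.\<close>

lemma geometric_counts_determine:
  fixes q N M n r m :: nat
  assumes "q \<ge> 2" "n \<ge> 2" "(q - 1) * N + 1 = q ^ n" "((q - 1) * M + 1) * q = q ^ n"
    and "r \<ge> 2" "m \<ge> 2" "(r - 1) * N + 1 = r ^ m" "((r - 1) * M + 1) * r = r ^ m"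
  shows "q = r \<and> n = m"
proof -
  have N: "N = q * M + 1 \<and> M \<noteq> 0"
    if "q \<ge> 2" "n \<ge> 2" "(q - 1) * N + 1 = q ^ n" "((q - 1) * M + 1) * q = q ^ n" for q n :: nat
  proof
    \<comment> \<open>Writing \<open>q\<close> as \<open>k + 2\<close> removes the truncated
      subtraction and exhibits the factor to cancel as a successor.\<close>
    define k where "k = q - 2"
    have k: "q = Suc (Suc k)" using that(1) by (simp add: k_def)
    have "(q - 1) * N + 1 = ((q - 1) * M + 1) * q" using that(3,4) by (rule trans[OF _ sym])
    then have "Suc k * N = Suc k * (q * M + 1)"
      unfolding k by (simp add: algebra_simps)
    then show "N = q * M + 1" by (simp only: Suc_mult_cancel1)
    show "M \<noteq> 0"
    proof
      assume "M = 0"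
      then have "q ^ 1 = q ^ n" using that(4) by simp
      then show False using that(1,2) power_inject_exp[of q 1 n] by simp
    qed
  qed
  have "q * M = r * M" "M \<noteq> 0" using N[of q n] N[of r m] assms by auto
  then have "q = r" by simp
  moreover have "n = m" using assms \<open>q = r\<close> power_inject_exp[of q n m] by simp
  ultimately show ?thesis by simp
qed

lemma Spi_iso_parameters:
  assumes \<nu>: "\<nu> \<ge> 1" "\<mu> \<ge> 1"
    and bij: "bij_betw f (Spi_verts TYPE('a::{field,finite}) \<nu>) (Spi_verts TYPE('b::{field,finite}) \<mu>)"
    and adj: "\<And>A B. A \<in> Spi_verts TYPE('a) \<nu> \<Longrightarrow> B \<in> Spi_verts TYPE('a) \<nu> \<Longrightarrow>
      B \<in> Spi_nbrs \<nu> A \<longleftrightarrow> f B \<in> Spi_nbrs \<mu> (f A)"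
  shows "CARD('a) = CARD('b) \<and> \<nu> = \<mu>"
proof -
  let ?V = "Spi_verts TYPE('a) \<nu>" and ?U = "Spi_verts TYPE('b) \<mu>"
  let ?L = "vec_lines (2 * \<nu>) (carrier_vec (2 * \<nu>)) :: 'a vec set set"
  let ?K = "vec_lines (2 * \<mu>) (carrier_vec (2 * \<mu>)) :: 'b vec set set"
  have inj: "inj_on f ?V" and img: "f ` ?V = ?U" using bij by (auto simp: bij_betw_def)
  \<comment> \<open>Neighbourhoods consist of vertices and \<open>f\<close> is onto, so inclusions
    between them can be tested through \<open>f\<close>.\<close>
  have sub: "Spi_nbrs \<nu> A \<subseteq> Spi_nbrs \<nu> B \<longleftrightarrow> Spi_nbrs \<mu> (f A) \<subseteq> Spi_nbrs \<mu> (f B)"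
    if "A \<in> ?V" "B \<in> ?V" for A B
  proof -
    have "Spi_nbrs \<nu> A \<subseteq> ?V" "Spi_nbrs \<mu> (f A) \<subseteq> f ` ?V"
      unfolding img by (auto simp: Spi_nbrs_iff)
    then show ?thesis using adj that by (auto simp: subset_eq)
  qed
  have LV: "?L \<subseteq> ?V" by (auto simp: vec_lines_eq_maximal_nbrs[OF \<nu>(1)])
  have mem: "A \<in> ?L \<longleftrightarrow> f A \<in> ?K" if "A \<in> ?V" for A
    unfolding vec_lines_eq_maximal_nbrs[OF \<nu>(1)] vec_lines_eq_maximal_nbrs[OF \<nu>(2)]
    using that sub inj by (auto simp: inj_on_eq_iff simp flip: img)
  have K: "f ` ?L = ?K"
  proof -
    have "?K \<subseteq> f ` ?V" unfolding img by (auto simp: vec_lines_eq_maximal_nbrs[OF \<nu>(2)])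
    then show ?thesis using mem LV by blast
  qed
  obtain v :: "'a vec" where v: "v \<in> carrier_vec (2 * \<nu>)" "v \<noteq> 0\<^sub>v (2 * \<nu>)"
    using \<nu>(1) unit_vec_nonzero[of 0 "2 * \<nu>"] by (intro that[of "unit_vec (2 * \<nu>) 0"]) auto
  let ?l = "vec_line v"
  have l: "?l \<in> ?V" by (rule vec_line_vertex[OF \<nu>(1) v])
  have "?l \<in> ?L" using v by (auto simp: vec_lines_def)
  then have "f ?l \<in> ?K" using K by blast
  then obtain w where w: "w \<in> carrier_vec (2 * \<mu>)" "w \<noteq> 0\<^sub>v (2 * \<mu>)" "f ?l = vec_line w"
    by (auto simp: vec_lines_def)
  \<comment> \<open>The lines adjacent to one fixed line correspond to those adjacent to its image,
    which is again a line; this equates the second count.\<close>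
  have M: "f ` (?L \<inter> Spi_nbrs \<nu> ?l) = ?K \<inter> Spi_nbrs \<mu> (f ?l)"
    using adj[OF l] LV unfolding K[symmetric] by blast
  have "inj_on f ?L" using inj LV by (rule inj_on_subset)
  then have N: "card ?L = card ?K" using K card_image by metis
  have "inj_on f (?L \<inter> Spi_nbrs \<nu> ?l)" using inj LV by (meson inj_on_subset inf.coboundedI1)
  then have M': "card (vec_lines (2 * \<nu>) (vec_perp \<nu> v)) = card (vec_lines (2 * \<mu>) (vec_perp \<mu> w))"
    using M card_image vec_lines_nbrs[OF \<nu>(1) v] vec_lines_nbrs[OF \<nu>(2) w(1,2)] w(3) by metis
  have "CARD('a) = CARD('b) \<and> 2 * \<nu> = 2 * \<mu>"
  proof (rule geometric_counts_determine)
    show "(CARD('a) - 1) * card ?L + 1 = CARD('a) ^ (2 * \<nu>)"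
      using card_vec_lines[OF vec_subspace_carrier] by (simp add: card_carrier_vec)
    show "(CARD('b) - 1) * card ?L + 1 = CARD('b) ^ (2 * \<mu>)"
      unfolding N using card_vec_lines[OF vec_subspace_carrier] by (simp add: card_carrier_vec)
    show "((CARD('a) - 1) * card (vec_lines (2 * \<nu>) (vec_perp \<nu> v)) + 1) * CARD('a) = CARD('a) ^ (2 * \<nu>)"
      unfolding card_vec_lines[OF vec_subspace_perp[OF v(1)]] by (rule card_vec_perp[OF v])
    show "((CARD('b) - 1) * card (vec_lines (2 * \<nu>) (vec_perp \<nu> v)) + 1) * CARD('b) = CARD('b) ^ (2 * \<mu>)"
      unfolding M' card_vec_lines[OF vec_subspace_perp[OF w(1)]] by (rule card_vec_perp[OF w(1,2)])
  qed (use \<nu> in \<open>auto simp: CARD_field_ge_2\<close>)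
  then show ?thesis by simp
qed

section \<open>Graph isomorphisms induced by field isomorphisms\<close>

context
  fixes \<phi> :: "'a::field \<Rightarrow> 'b::field"
  assumes hom: "field_hom \<phi>" and bij: "bij \<phi>"
begin

interpretation field_hom \<phi> by (rule hom)

lemma bij_map_vec: "bij (map_vec \<phi>)"
proof (rule bijI')
  show "map_vec \<phi> v = map_vec \<phi> w \<longleftrightarrow> v = w" for v w
    using vec_hom_inj by blast
  show "\<exists>v. w = map_vec \<phi> v" for w
    using bij by (intro exI[of _ "map_vec (inv_into UNIV \<phi>) w"] eq_vecI) (auto simp: bij_is_surj surj_f_inv_f)
qed

text \<open>The equivalence, rather than one implication, lets preimages of vertices be handled
  without a separate treatment of the inverse map.\<close>

lemma vec_subspace_map_vec: "vec_subspace n (map_vec \<phi> ` W) \<longleftrightarrow> vec_subspace n W"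
proof -
  have mem: "map_vec \<phi> x \<in> map_vec \<phi> ` W \<longleftrightarrow> x \<in> W" for x
    using bij_map_vec by (simp add: bij_is_inj inj_image_mem_iff)
  have carrier: "map_vec \<phi> ` W \<subseteq> carrier_vec n \<longleftrightarrow> W \<subseteq> carrier_vec n" by auto
  have zero: "0\<^sub>v n \<in> map_vec \<phi> ` W \<longleftrightarrow> 0\<^sub>v n \<in> W"
    using mem[of "0\<^sub>v n"] by (simp add: vec_hom_zero)
  have add: "map_vec \<phi> v + map_vec \<phi> w \<in> map_vec \<phi> ` W \<longleftrightarrow> v + w \<in> W"
    if "W \<subseteq> carrier_vec n" "v \<in> W" "w \<in> W" for v w
  proof -
    have "v \<in> carrier_vec n" "w \<in> carrier_vec n" using that by auto
    then have "map_vec \<phi> (v + w) = map_vec \<phi> v + map_vec \<phi> w"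
      by (intro eq_vecI) (auto simp: hom_add)
    then show ?thesis using mem by metis
  qed
  \<comment> \<open>Since the field map is onto, quantifying over scalars of the target is the same
    as quantifying over images of scalars.\<close>
  have smult: "(\<forall>c. c \<cdot>\<^sub>v map_vec \<phi> v \<in> map_vec \<phi> ` W) \<longleftrightarrow> (\<forall>c. c \<cdot>\<^sub>v v \<in> W)" for v
  proof -
    have "(\<forall>c. c \<cdot>\<^sub>v map_vec \<phi> v \<in> map_vec \<phi> ` W) \<longleftrightarrow>
        (\<forall>c. \<phi> c \<cdot>\<^sub>v map_vec \<phi> v \<in> map_vec \<phi> ` W)"
      using bij by (metis bij_pointE)
    then show ?thesis using mem by (simp flip: vec_hom_smult)
  qed
  have "(\<forall>c. \<forall>u\<in>map_vec \<phi> ` W. c \<cdot>\<^sub>v u \<in> map_vec \<phi> ` W) \<longleftrightarrow>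
      (\<forall>v\<in>W. \<forall>c. c \<cdot>\<^sub>v map_vec \<phi> v \<in> map_vec \<phi> ` W)" by blast
  also have "\<dots> \<longleftrightarrow> (\<forall>c. \<forall>v\<in>W. c \<cdot>\<^sub>v v \<in> W)" unfolding smult by blast
  finally show ?thesis unfolding vec_subspace_def carrier zero using add by auto
qed

text \<open>The entries of the matrix are 0, 1 and -1, which a field homomorphism fixes, so it
  commutes with the form.\<close>

lemma symplectic_form_map_vec:
  assumes "a \<in> carrier_vec (2 * \<nu>)" "b \<in> carrier_vec (2 * \<nu>)"
  shows "symplectic_form \<nu> (map_vec \<phi> a) (map_vec \<phi> b) = \<phi> (symplectic_form \<nu> a b)"
proof -
  have "map_mat \<phi> (symplectic_mat \<nu>) = symplectic_mat \<nu>"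
    by (rule eq_matI) (auto simp: symplectic_mat_def hom_uminus)
  then have *: "symplectic_mat \<nu> *\<^sub>v map_vec \<phi> b = map_vec \<phi> (symplectic_mat \<nu> *\<^sub>v b)"
    using mult_mat_vec_hom[OF symplectic_mat_carrier assms(2)] by metis
  have scalar: "map_vec \<phi> u \<bullet> map_vec \<phi> w = \<phi> (u \<bullet> w)"
    if "dim_vec u = dim_vec w" for u w
    using that unfolding scalar_prod_def by (simp add: hom_sum hom_mult)
  show ?thesis unfolding symplectic_form_def *
    using assms(1) by (intro scalar) (simp add: carrier_matD(1)[OF symplectic_mat_carrier])
qed

lemma map_vec_Spi_iso:
  "bij_betw ((`) (map_vec \<phi>)) (Spi_verts TYPE('a) \<nu>) (Spi_verts TYPE('b) \<nu>)"
  "A \<in> Spi_verts TYPE('a) \<nu> \<Longrightarrow> B \<in> Spi_verts TYPE('a) \<nu> \<Longrightarrow>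
     (A, B) \<in> parcs (Spi TYPE('a) \<nu>) \<longleftrightarrow>
     (map_vec \<phi> ` A, map_vec \<phi> ` B) \<in> parcs (Spi TYPE('b) \<nu>)"
proof -
  let ?h = "map_vec \<phi>" and ?n = "2 * \<nu>"
  have inj: "inj ?h" and surj: "surj ?h" using bij_map_vec by (auto simp: bij_def)
  have zero: "?h ` {0\<^sub>v ?n} = {0\<^sub>v ?n}" by (simp add: vec_hom_zero)
  have carrier: "?h ` carrier_vec ?n = carrier_vec ?n"
    using surj by (auto simp: image_iff) (metis map_carrier_vec surjD)
  have vert: "?h ` W \<in> Spi_verts TYPE('b) \<nu> \<longleftrightarrow> W \<in> Spi_verts TYPE('a) \<nu>" for W
    unfolding Spi_verts_iff vec_subspace_map_vec
    using inj_image_eq_iff[OF inj, of W] zero carrier by metis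
  show "bij_betw ((`) ?h) (Spi_verts TYPE('a) \<nu>) (Spi_verts TYPE('b) \<nu>)"
  proof (rule bij_betwI[of _ _ _ "vimage ?h"])
    show "vimage ?h \<in> Spi_verts TYPE('b) \<nu> \<rightarrow> Spi_verts TYPE('a) \<nu>"
      using surj by (auto simp: surj_image_vimage_eq simp flip: vert)
  qed (use inj surj in \<open>auto simp: vert inj_vimage_image_eq surj_image_vimage_eq\<close>)
  assume AB: "A \<in> Spi_verts TYPE('a) \<nu>" "B \<in> Spi_verts TYPE('a) \<nu>"
  have "symplectic_form \<nu> (?h a) (?h b) = 0 \<longleftrightarrow> symplectic_form \<nu> a b = 0"
    if "a \<in> A" "b \<in> B" for a b
  proof -
    have "a \<in> carrier_vec ?n" "b \<in> carrier_vec ?n"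
      using that Spi_verts_carrier[OF AB(1)] Spi_verts_carrier[OF AB(2)] by auto
    then show ?thesis by (simp add: symplectic_form_map_vec)
  qed
  then show "(A, B) \<in> parcs (Spi TYPE('a) \<nu>) \<longleftrightarrow> (?h ` A, ?h ` B) \<in> parcs (Spi TYPE('b) \<nu>)"
    using AB by (simp add: Spi_def vert)
qed

end

theorem theorem2p2:
  fixes q\<^sub>1 q\<^sub>2 \<nu>\<^sub>1 \<nu>\<^sub>2 :: nat
  assumes "primepow q\<^sub>1" and "primepow q\<^sub>2"
    and "CARD('a::{field,finite}) = q\<^sub>1" and "CARD('b::{field,finite}) = q\<^sub>2"
    and "\<nu>\<^sub>1 \<ge> 1" and "\<nu>\<^sub>2 \<ge> 1"
  shows "digraph_iso (with_proj (Spi TYPE('a) \<nu>\<^sub>1)) (with_proj (Spi TYPE('b) \<nu>\<^sub>2))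
           \<longleftrightarrow> \<nu>\<^sub>1 = \<nu>\<^sub>2 \<and> q\<^sub>1 = q\<^sub>2"
proof -
  have wf: "pair_wf_digraph (Spi TYPE('c::{field,finite}) \<nu>)" for \<nu>
    using Spi_pseudo_graph pair_pseudo_graph.axioms(1) pair_fin_digraph.axioms(1) by blast
  have pv: "pverts (Spi TYPE('c::field) \<nu>) = Spi_verts TYPE('c) \<nu>" for \<nu>
    by (simp add: Spi_def)
  \<comment> \<open>Isomorphism becomes a bijection of vertices that preserves and reflects
    adjacency, loops included.\<close>
  note iso_iff = digraph_iso_with_proj_iff[OF wf wf, unfolded pv]
  show ?thesis
  proof
    assume "digraph_iso (with_proj (Spi TYPE('a) \<nu>\<^sub>1)) (with_proj (Spi TYPE('b) \<nu>\<^sub>2))"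
    then obtain f where "bij_betw f (Spi_verts TYPE('a) \<nu>\<^sub>1) (Spi_verts TYPE('b) \<nu>\<^sub>2)"
      and "\<forall>A\<in>Spi_verts TYPE('a) \<nu>\<^sub>1. \<forall>B\<in>Spi_verts TYPE('a) \<nu>\<^sub>1.
        (A, B) \<in> parcs (Spi TYPE('a) \<nu>\<^sub>1) \<longleftrightarrow> (f A, f B) \<in> parcs (Spi TYPE('b) \<nu>\<^sub>2)"
      unfolding iso_iff by blast
    then have "CARD('a) = CARD('b) \<and> \<nu>\<^sub>1 = \<nu>\<^sub>2"
      using assms(5,6) by (intro Spi_iso_parameters) (auto simp: Spi_nbrs_def)
    then show "\<nu>\<^sub>1 = \<nu>\<^sub>2 \<and> q\<^sub>1 = q\<^sub>2" using assms(3,4) by simp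
  next
    assume eq: "\<nu>\<^sub>1 = \<nu>\<^sub>2 \<and> q\<^sub>1 = q\<^sub>2"
    obtain \<phi> :: "'a \<Rightarrow> 'b" where "field_hom \<phi>" "bij \<phi>"
    proof (rule finite_fields_isomorphic)
      show "primepow CARD('a)" "CARD('a) = CARD('b)" using assms(1,3,4) eq by simp_all
    qed
    then show "digraph_iso (with_proj (Spi TYPE('a) \<nu>\<^sub>1)) (with_proj (Spi TYPE('b) \<nu>\<^sub>2))"
      using map_vec_Spi_iso[of \<phi>] eq unfolding iso_iff by blast
  qed
qed

end
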